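(* Suppose that the semicontinuous-model assumption (conditions (A1)–(A5) of the context) holds, and that $v_t^\star$ and $\hat v_t$ are convex on $\mathcal{Z}_t$ for all $t$. Then $$0\le v_t^{\hat\pi}(x)-v_t^\star(x)\le\sum_{k=t+1}^K L_k\,\delta\qquad\text{for all }x\in\mathcal{Z}_t\text{ and all }t=0,\ldots,K,$$ where $L_k:=\sup_{j=1,\ldots,N_{\mathcal{C},k}}\ \sup_{x,x'\in\mathcal{C}_j,\ x\ne x'}\frac{|v_k^\star(x)-v_k^\star(x')|}{\|x-x'\|}$, and therefore $v_t^{\hat\pi}$ converges uniformly to $v_t^\star$ on $\mathcal{Z}_t$ as $\delta\to0$.
   Context: Control problem. Let $K\ge 1$ be an integer, $\mathcal{X}\subseteq\mathbb{R}^n$, $\mathcal{U}\subseteq\mathbb{R}^m$, $\Xi\subseteq\mathbb{R}^l$ Borel sets, and for each $x\in\mathcal{X}$ let $\mathcal{U}(x)\subseteq\mathcal{U}$ be a nonempty Borel set of admissible actions; put $\mathcal{K}:=\{(x,u): x\in\mathcal{X},\,u\in\mathcal{U}(x)\}$. Let $f:\mathcal{X}\times\mathcal{U}\times\Xi\to\mathcal{X}$, $r:\mathcal{X}\times\mathcal{U}\to\mathbb{R}$ (stage cost) and $q:\mathcal{X}\to\mathbb{R}$ (terminal cost) be measurable. The system is $x_{t+1}=f(x_t,u_t,\xi_t)$ with i.i.d. disturbances $\xi_t$ distributed as $\xi$ with values in $\Xi$. Semicontinuous-model assumption: (A1) $\mathcal{U}(x)$ is compact for each $x\in\mathcal{X}$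 and the multifunction $x\mapsto\mathcal{U}(x)$ is upper semicontinuous. (A2) $r$ and $q$ are lower semicontinuous on $\mathcal{K}$ and $\mathcal{X}$, respectively. (A3) There exist nonnegative constants $\bar r,\bar q,\beta$ with $\beta\ge1$ and a continuous function $w:\mathcal{X}\to[1,\infty)$ such that $|r(x,u)|\le\bar r w(x)$, $|q(x)|\le\bar q w(x)$ and $\mathbb{E}[w(f(x,u,\xi))]\le\beta w(x)$ for all $(x,u)\in\mathcal{K}$. (A4) $(x,u)\mapsto f(x,u,\boldsymbol{\xi})$ is continuous on $\mathcal{K}$ for each $\boldsymbol{\xi}\in\Xi$. (A5) $\Xi=\{\hat\xi^{[1]},\ldots,\hat\xi^{[N]}\}$ is finite. Write $p_s:=\mathrm{Prob}(\xi=\hat\xi^{[s]})$, $\sum_{s=1}^N p_s=1$, and $\mathcal{S}:=\{1,\ldots,N\}$. Discretization. $\mathcal{Z}_0\subseteq\mathcal{Z}_1\subseteq\cdots\subseteq\mathcal{Z}_K\subseteq\mathcal{X}$ are convex compact sets with $\{f(x,u,\boldsymbol{\xi}):x\in\mathcal{Z}_t,u\in\mathcal{U}(x),\boldsymbol{\xi}\in\Xi\}\subseteq\mathcal{Z}_{t+1}$ for $t=0,\ldots,K-1$. $\mathcal{C}_1,\ldots,\mathcal{C}_{N_{\mathcal{C}}}$ are convex compact subsets (cells) of $\mathcal{Z}_K$ with pairwise disjoint interiors, and there are $N_{\mathcal{C},0}\le\cdots\le N_{\mathcal{C},K}=N_{\mathcal{C}}$ with $\bigcup_{i=1}^{N_{\mathcal{C},t}}\mathcal{C}_i=\mathcal{Z}_t$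 for every $t$. Nodes $x^{[1]},\ldots,x^{[M_K]}\in\mathcal{Z}_K$ are chosen so that each $\mathcal{C}_i$ is the convex hull of a subset of the nodes, and $M_0\le\cdots\le M_K$ are such that $x^{[1]},\ldots,x^{[M_t]}$ are exactly the nodes lying in $\mathcal{Z}_t$. Set $\delta:=\max_{k}\max_{x^{[i]},x^{[j]}\in\mathcal{C}_k}\|x^{[i]}-x^{[j]}\|$. "As $\delta\to0$" means that the sets $\mathcal{Z}_t$ are fixed while cells and nodes vary so that $\delta\to0$. Optimal value function. $v_K^{opt}:=q$ and $v_t^{opt}(x):=\inf_{u\in\mathcal{U}(x)}\{r(x,u)+\sum_{s=1}^N p_s v_{t+1}^{opt}(f(x,u,\hat\xi^{[s]}))\}$ for $x\in\mathcal{X}$, $t=K-1,\ldots,0$ (this is the minimal expected cost-to-go $\inf_\pi\mathbb{E}^\pi[\sum_{k=t}^{K-1}r(x_k,u_k)+q(x_K)\mid x_t=x]$); $v_t^\star$ is the restriction of $v_t^{opt}$ to $\mathcal{Z}_t$. Approximate operator. For bounded measurable $v:\mathcal{Z}_{t+1}\to\mathbb{R}$ and $x\in\mathcal{Z}_t$, $$(\hat T_t v)(x):=\inf_{u,\gamma}\Big\{r(x,u)+\sum_{s=1}^N\sum_{i=1}^{M_{t+1}}p_s\gamma_{s,i}v(x^{[i]})\ :\ f(x,u,\hat\xi^{[s]})=\sum_{i=1}^{M_{t+1}}\gamma_{s,i}x^{[i]},\ \gamma_s\in\Delta\ \forall s\in\mathcal{S},\ u\in\mathcal{U}(x)\Big\},$$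 where $\Delta:=\{\gamma\in\mathbb{R}^{M_{t+1}}:\sum_i\gamma_i=1,\ \gamma_i\ge0\}$. Define $\hat v_K:=q$ on $\mathcal{Z}_K$ and $\hat v_t:=\hat T_t\hat v_{t+1}$ on $\mathcal{Z}_t$ for $t=K-1,\ldots,0$. Approximate policy. $\hat\pi=(\hat\pi_0,\ldots,\hat\pi_{K-1})$, where for each $x\in\mathcal{Z}_t$, $\hat\pi_t(x)\in\mathcal{U}(x)$ is the $u$-component of an optimal solution $(u,\gamma)$ of the minimization problem defining $(\hat T_t\hat v_{t+1})(x)$. Its cost-to-go is $v_K^{\hat\pi}:=q$ on $\mathcal{Z}_K$ and $v_t^{\hat\pi}(x):=r(x,\hat\pi_t(x))+\sum_{s=1}^N p_s v_{t+1}^{\hat\pi}(f(x,\hat\pi_t(x),\hat\xi^{[s]}))$ for $x\in\mathcal{Z}_t$. Conventions: a supremum over the empty set is $0$, an empty sum is $0$; an upper bound by $+\infty$ is vacuous. *)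

theory Defs
  imports "HOL-Probability.Probability"
begin

section \<open>Semicontinuity\<close>

definition lsc_on :: "'a::topological_space set \<Rightarrow> ('a \<Rightarrow> real) \<Rightarrow> bool" where
  "lsc_on S g \<longleftrightarrow> (\<forall>a. openin (top_of_set S) {x \<in> S. a < g x})"

definition usc_multifunction :: "'a::topological_space set \<Rightarrow> ('a \<Rightarrow> 'b::topological_space set) \<Rightarrow> bool" where
  "usc_multifunction S F \<longleftrightarrow> (\<forall>V. open V \<longrightarrow> openin (top_of_set S) {x \<in> S. F x \<subseteq> V})"


section \<open>The control problem\<close>

text \<open>
  All functions are total in HOL; only their values on the sets below matter.
  The disturbance set \<open>disturbances\<close> is listed as \<open>scenario 1, ..., scenario num_scenarios\<close>
  once it is assumed finite. \<open>disturbance\<close> is the generic random disturbance and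
  \<open>noise t\<close> the one that acts at stage \<open>t\<close>.
\<close>

record ('n::finite, 'm::finite, 'l::finite, 'w) control_problem =
  horizon :: nat
  states :: "(real ^ 'n) set"
  actions :: "(real ^ 'm) set"
  disturbances :: "(real ^ 'l) set"
  admissible :: "real ^ 'n \<Rightarrow> (real ^ 'm) set"
  dynamics :: "real ^ 'n \<Rightarrow> real ^ 'm \<Rightarrow> real ^ 'l \<Rightarrow> real ^ 'n"
  stage_cost :: "real ^ 'n \<Rightarrow> real ^ 'm \<Rightarrow> real"
  terminal_cost :: "real ^ 'n \<Rightarrow> real"
  sample_space :: "'w measure"
  disturbance :: "'w \<Rightarrow> real ^ 'l"
  noise :: "nat \<Rightarrow> 'w \<Rightarrow> real ^ 'l"
  num_scenarios :: nat
  scenario :: "nat \<Rightarrow> real ^ 'l"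

definition admissible_pairs ::
    "('n::finite, 'm::finite, 'l::finite, 'w) control_problem \<Rightarrow> ((real ^ 'n) \<times> (real ^ 'm)) set" where
  "admissible_pairs m = {(x, u). x \<in> states m \<and> u \<in> admissible m x}"

definition control_model ::
    "('n::finite, 'm::finite, 'l::finite, 'w) control_problem \<Rightarrow> bool" where
  "control_model m \<longleftrightarrow>
     horizon m \<ge> 1 \<and>
     states m \<in> sets borel \<and> actions m \<in> sets borel \<and> disturbances m \<in> sets borel \<and>
     (\<forall>x\<in>states m. admissible m x \<subseteq> actions m \<and> admissible m x \<noteq> {} \<and>
        admissible m x \<in> sets borel) \<and>
     (\<forall>x\<in>states m. \<forall>u\<in>actions m. \<forall>z\<in>disturbances m. dynamics m x u z \<in> states m) \<and>
     (\<lambda>(x, u, z). dynamics m x u z)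
        \<in> borel_measurable (restrict_space borel (states m \<times> actions m \<times> disturbances m)) \<and>
     (\<lambda>(x, u). stage_cost m x u)
        \<in> borel_measurable (restrict_space borel (states m \<times> actions m)) \<and>
     terminal_cost m \<in> borel_measurable (restrict_space borel (states m)) \<and>
     prob_space (sample_space m) \<and>
     disturbance m \<in> borel_measurable (sample_space m) \<and>
     (\<forall>\<omega>\<in>space (sample_space m). disturbance m \<omega> \<in> disturbances m) \<and>
     prob_space.indep_vars (sample_space m) (\<lambda>_. borel) (noise m) {..<horizon m} \<and>
     (\<forall>t<horizon m. distr (sample_space m) borel (noise m t)
        = distr (sample_space m) borel (disturbance m))"

definition scenario_prob ::
    "('n::finite, 'm::finite, 'l::finite, 'w) control_problem \<Rightarrow> nat \<Rightarrow> real" where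
  "scenario_prob m s =
     measure (sample_space m) {\<omega> \<in> space (sample_space m). disturbance m \<omega> = scenario m s}"

text \<open>
  In the growth condition the disturbance has finitely many values, so the expectation is
  the integral of a simple function and integrability is automatic. The scenarios are not
  required to be distinct, but the condition that the probabilities sum to one allows
  repetitions only of scenarios of probability zero.
\<close>

definition semicontinuous_model ::
    "('n::finite, 'm::finite, 'l::finite, 'w) control_problem \<Rightarrow> bool" where
  "semicontinuous_model m \<longleftrightarrow>
     control_model m \<and>
     (\<forall>x\<in>states m. compact (admissible m x)) \<and>
     usc_multifunction (states m) (admissible m) \<and>
     lsc_on (admissible_pairs m) (\<lambda>(x, u). stage_cost m x u) \<and>
     lsc_on (states m) (terminal_cost m) \<and>
     (\<exists>rbar qbar \<beta> w. 0 \<le> rbar \<and> 0 \<le> qbar \<and> 1 \<le> \<beta> \<and>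
        continuous_on (states m) w \<and> (\<forall>x\<in>states m. 1 \<le> w x) \<and>
        (\<forall>(x, u)\<in>admissible_pairs m.
           \<bar>stage_cost m x u\<bar> \<le> rbar * w x \<and>
           \<bar>terminal_cost m x\<bar> \<le> qbar * w x \<and>
           (\<integral>\<omega>. w (dynamics m x u (disturbance m \<omega>)) \<partial>sample_space m) \<le> \<beta> * w x)) \<and>
     (\<forall>z\<in>disturbances m. continuous_on (admissible_pairs m) (\<lambda>(x, u). dynamics m x u z)) \<and>
     disturbances m = scenario m ` {1..num_scenarios m} \<and>
     (\<Sum>s=1..num_scenarios m. scenario_prob m s) = 1"


section \<open>Optimal value function\<close>

text \<open>The infima below are infima of sets of reals; in a semicontinuous model these sets are
  nonempty and bounded below at all states that matter.\<close>

definition bellman ::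
    "('n::finite, 'm::finite, 'l::finite, 'w) control_problem \<Rightarrow> (real ^ 'n \<Rightarrow> real) \<Rightarrow> real ^ 'n \<Rightarrow> real"
  where
  "bellman m v x =
     (INF u\<in>admissible m x.
        stage_cost m x u
        + (\<Sum>s=1..num_scenarios m. scenario_prob m s * v (dynamics m x u (scenario m s))))"

function v_opt ::
    "('n::finite, 'm::finite, 'l::finite, 'w) control_problem \<Rightarrow> nat \<Rightarrow> real ^ 'n \<Rightarrow> real" where
  "v_opt m t = (if t < horizon m then bellman m (v_opt m (Suc t)) else terminal_cost m)"
  by auto
termination by (relation "Wellfounded.measure (\<lambda>(m, t). horizon m - t)") auto

declare v_opt.simps [simp del]


section \<open>Discretization\<close>

definition state_regions ::
    "('n::finite, 'm::finite, 'l::finite, 'w) control_problem \<Rightarrow> (nat \<Rightarrow> (real ^ 'n) set) \<Rightarrow> bool" where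
  "state_regions m Z \<longleftrightarrow>
     (\<forall>t\<le>horizon m. convex (Z t) \<and> compact (Z t)) \<and>
     (\<forall>t<horizon m. Z t \<subseteq> Z (Suc t)) \<and>
     Z (horizon m) \<subseteq> states m \<and>
     (\<forall>t<horizon m. \<forall>x\<in>Z t. \<forall>u\<in>admissible m x. \<forall>z\<in>disturbances m.
        dynamics m x u z \<in> Z (Suc t))"

text \<open>Cells and nodes are numbered from 1. The first \<open>num_cells t\<close> cells and the first
  \<open>num_nodes t\<close> nodes are those of the region of stage \<open>t\<close>.\<close>

record ('n::finite) grid =
  num_cells :: "nat \<Rightarrow> nat"
  cell :: "nat \<Rightarrow> (real ^ 'n) set"
  num_nodes :: "nat \<Rightarrow> nat"
  node :: "nat \<Rightarrow> real ^ 'n"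

definition discretization ::
    "('n::finite, 'm::finite, 'l::finite, 'w) control_problem \<Rightarrow> (nat \<Rightarrow> (real ^ 'n) set) \<Rightarrow> 'n grid \<Rightarrow> bool"
  where
  "discretization m Z d \<longleftrightarrow>
     (let K = horizon m in
       (\<forall>i\<in>{1..num_cells d K}. convex (cell d i) \<and> compact (cell d i) \<and> cell d i \<subseteq> Z K) \<and>
       (\<forall>i\<in>{1..num_cells d K}. \<forall>j\<in>{1..num_cells d K}. i \<noteq> j \<longrightarrow>
          interior (cell d i) \<inter> interior (cell d j) = {}) \<and>
       (\<forall>t<K. num_cells d t \<le> num_cells d (Suc t)) \<and>
       (\<forall>t\<le>K. (\<Union>i\<in>{1..num_cells d t}. cell d i) = Z t) \<and>
       (\<forall>i\<in>{1..num_nodes d K}. node d i \<in> Z K) \<and>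
       (\<forall>i\<in>{1..num_cells d K}. \<exists>I\<subseteq>{1..num_nodes d K}. cell d i = convex hull (node d ` I)) \<and>
       (\<forall>t<K. num_nodes d t \<le> num_nodes d (Suc t)) \<and>
       (\<forall>t\<le>K. \<forall>i\<in>{1..num_nodes d K}. node d i \<in> Z t \<longleftrightarrow> i \<le> num_nodes d t))"

text \<open>The element \<open>0\<close> is inserted only to give the maximum the value \<open>0\<close> when no cell
  contains a node (which can only happen when all regions are empty).\<close>

definition mesh ::
    "('n::finite, 'm::finite, 'l::finite, 'w) control_problem \<Rightarrow> 'n grid \<Rightarrow> real" where
  "mesh m d =
     Max (insert 0 {norm (node d i - node d j) | k i j.
       k \<in> {1..num_cells d (horizon m)} \<and>
       i \<in> {1..num_nodes d (horizon m)} \<and> j \<in> {1..num_nodes d (horizon m)} \<and>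
       node d i \<in> cell d k \<and> node d j \<in> cell d k})"


section \<open>Approximate operator, value functions and policies\<close>

definition feasible ::
    "('n::finite, 'm::finite, 'l::finite, 'w) control_problem \<Rightarrow> 'n grid \<Rightarrow> nat \<Rightarrow> real ^ 'n \<Rightarrow>
     (real ^ 'm) \<times> (nat \<Rightarrow> nat \<Rightarrow> real) \<Rightarrow> bool" where
  "feasible m d t x = (\<lambda>(u, \<gamma>).
     u \<in> admissible m x \<and>
     (\<forall>s\<in>{1..num_scenarios m}.
        dynamics m x u (scenario m s) = (\<Sum>i=1..num_nodes d (Suc t). \<gamma> s i *\<^sub>R node d i) \<and>
        (\<Sum>i=1..num_nodes d (Suc t). \<gamma> s i) = 1 \<and>
        (\<forall>i\<in>{1..num_nodes d (Suc t)}. 0 \<le> \<gamma> s i)))"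

definition objective ::
    "('n::finite, 'm::finite, 'l::finite, 'w) control_problem \<Rightarrow> 'n grid \<Rightarrow> nat \<Rightarrow> (real ^ 'n \<Rightarrow> real) \<Rightarrow>
     real ^ 'n \<Rightarrow> (real ^ 'm) \<times> (nat \<Rightarrow> nat \<Rightarrow> real) \<Rightarrow> real" where
  "objective m d t v x = (\<lambda>(u, \<gamma>).
     stage_cost m x u
     + (\<Sum>s=1..num_scenarios m. \<Sum>i=1..num_nodes d (Suc t).
          scenario_prob m s * \<gamma> s i * v (node d i)))"

definition approx_operator ::
    "('n::finite, 'm::finite, 'l::finite, 'w) control_problem \<Rightarrow> 'n grid \<Rightarrow> nat \<Rightarrow> (real ^ 'n \<Rightarrow> real) \<Rightarrow>
     real ^ 'n \<Rightarrow> real" where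
  "approx_operator m d t v x = (INF c\<in>Collect (feasible m d t x). objective m d t v x c)"

function v_hat ::
    "('n::finite, 'm::finite, 'l::finite, 'w) control_problem \<Rightarrow> 'n grid \<Rightarrow> nat \<Rightarrow> real ^ 'n \<Rightarrow> real" where
  "v_hat m d t =
     (if t < horizon m then approx_operator m d t (v_hat m d (Suc t)) else terminal_cost m)"
  by auto
termination by (relation "Wellfounded.measure (\<lambda>(m, d, t). horizon m - t)") auto

declare v_hat.simps [simp del]

definition approx_policy ::
    "('n::finite, 'm::finite, 'l::finite, 'w) control_problem \<Rightarrow> (nat \<Rightarrow> (real ^ 'n) set) \<Rightarrow> 'n grid \<Rightarrow>
     (nat \<Rightarrow> real ^ 'n \<Rightarrow> real ^ 'm) \<Rightarrow> bool" where
  "approx_policy m Z d \<pi> \<longleftrightarrow>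
     (\<forall>t<horizon m. \<forall>x\<in>Z t. \<exists>\<gamma>.
        is_arg_min (objective m d t (v_hat m d (Suc t)) x) (feasible m d t x) (\<pi> t x, \<gamma>))"

function v_policy ::
    "('n::finite, 'm::finite, 'l::finite, 'w) control_problem \<Rightarrow> (nat \<Rightarrow> real ^ 'n \<Rightarrow> real ^ 'm) \<Rightarrow>
     nat \<Rightarrow> real ^ 'n \<Rightarrow> real" where
  "v_policy m \<pi> t =
     (if t < horizon m
      then (\<lambda>x. stage_cost m x (\<pi> t x)
              + (\<Sum>s=1..num_scenarios m. scenario_prob m s *
                   v_policy m \<pi> (Suc t) (dynamics m x (\<pi> t x) (scenario m s))))
      else terminal_cost m)"
  by auto
termination by (relation "Wellfounded.measure (\<lambda>(m, \<pi>, t). horizon m - t)") auto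

declare v_policy.simps [simp del]


section \<open>Error bound and vanishing mesh size\<close>

text \<open>Values in \<open>ennreal\<close>: the suprema may be infinite, and a supremum over the empty set is 0.\<close>

definition cell_lipschitz ::
    "('n::finite, 'm::finite, 'l::finite, 'w) control_problem \<Rightarrow> 'n grid \<Rightarrow> nat \<Rightarrow> ennreal" where
  "cell_lipschitz m d k =
     (SUP j\<in>{1..num_cells d k}.
        SUP (x, x')\<in>{(x, x'). x \<in> cell d j \<and> x' \<in> cell d j \<and> x \<noteq> x'}.
          ennreal (\<bar>v_opt m k x - v_opt m k x'\<bar> / norm (x - x')))"

definition convex_scheme ::
    "('n::finite, 'm::finite, 'l::finite, 'w) control_problem \<Rightarrow> (nat \<Rightarrow> (real ^ 'n) set) \<Rightarrow>
     'n grid \<Rightarrow> (nat \<Rightarrow> real ^ 'n \<Rightarrow> real ^ 'm) \<Rightarrow> bool" where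
  "convex_scheme m Z d \<pi> \<longleftrightarrow>
     discretization m Z d \<and>
     (\<forall>t\<le>horizon m. convex_on (Z t) (v_hat m d t)) \<and>
     approx_policy m Z d \<pi>"

text \<open>The regions \<open>Z\<close> stay fixed; grid and policy vary.\<close>

definition mesh_to_0 ::
    "('n::finite, 'm::finite, 'l::finite, 'w) control_problem \<Rightarrow> (nat \<Rightarrow> (real ^ 'n) set) \<Rightarrow>
     ('n grid \<times> (nat \<Rightarrow> real ^ 'n \<Rightarrow> real ^ 'm)) filter" where
  "mesh_to_0 m Z =
     inf (filtercomap (\<lambda>(d, \<pi>). mesh m d) (nhds 0)) (principal {(d, \<pi>). convex_scheme m Z d \<pi>})"

lemma mesh_nonneg: "0 \<le> mesh m d"
proof -
  let ?S = "{norm (node d i - node d j) | k i j.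
       k \<in> {1..num_cells d (horizon m)} \<and>
       i \<in> {1..num_nodes d (horizon m)} \<and> j \<in> {1..num_nodes d (horizon m)} \<and>
       node d i \<in> cell d k \<and> node d j \<in> cell d k}"
  have "?S \<subseteq> (\<lambda>(i, j). norm (node d i - node d j)) `
      ({1..num_nodes d (horizon m)} \<times> {1..num_nodes d (horizon m)})"
    by auto
  then have "finite ?S"
    by (rule finite_subset) simp
  then show ?thesis
    unfolding mesh_def by (intro Max_ge) auto
qed

lemma eventually_mesh_to_0:
  "eventually P (mesh_to_0 m Z) \<longleftrightarrow>
     (\<exists>\<eta>>0. \<forall>d \<pi>. convex_scheme m Z d \<pi> \<and> mesh m d < \<eta> \<longrightarrow> P (d, \<pi>))"
proof -
  have "eventually P (mesh_to_0 m Z) \<longleftrightarrow>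
      (\<exists>Q. eventually Q (nhds 0) \<and>
        (\<forall>d \<pi>. Q (mesh m d) \<longrightarrow> convex_scheme m Z d \<pi> \<longrightarrow> P (d, \<pi>)))"
    by (auto simp: mesh_to_0_def eventually_inf_principal eventually_filtercomap)
  also have "\<dots> \<longleftrightarrow> (\<exists>\<eta>>0. \<forall>d \<pi>. convex_scheme m Z d \<pi> \<and> mesh m d < \<eta> \<longrightarrow> P (d, \<pi>))"
    (is "?L \<longleftrightarrow> ?R")
  proof
    assume ?L
    then obtain Q where Q: "eventually Q (nhds (0::real))"
      "\<forall>d \<pi>. Q (mesh m d) \<longrightarrow> convex_scheme m Z d \<pi> \<longrightarrow> P (d, \<pi>)" by blast
    from Q(1) obtain \<eta> where "\<eta> > 0" "\<And>y. dist y 0 < \<eta> \<Longrightarrow> Q y"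
      unfolding eventually_nhds_metric by blast
    with Q(2) show ?R
      by (intro exI[of _ \<eta>]) (auto simp: mesh_nonneg)
  next
    assume ?R
    then obtain \<eta> where "\<eta> > 0" "\<forall>d \<pi>. convex_scheme m Z d \<pi> \<and> mesh m d < \<eta> \<longrightarrow> P (d, \<pi>)"
      by blast
    then show ?L
      by (intro exI[of _ "\<lambda>y. y < \<eta>"]) (auto intro: eventually_nhds_in_open[of "{..<\<eta>}", simplified])
  qed
  finally show ?thesis .
qed

end

theory Submission
  imports Defs
begin

text \<open>
  Convexity of \<open>v_hat\<close> and Jensen's inequality show that the policy performs no worse than the
  approximate scheme predicts, so the policy value lies between \<open>v_opt\<close> and \<open>v_hat\<close>. Conversely,
  the image state of any action can be interpolated by the nodes of a single cell containing it,
  so each stage raises \<open>v_hat\<close> above \<open>v_opt\<close> by at most the oscillation of \<open>v_opt\<close> on a cell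
  between a node and another point. This oscillation is at most \<open>L\<^sub>k \<delta>\<close>.

  For uniform convergence the bound by \<open>L\<^sub>k \<delta>\<close> is useless, as \<open>L\<^sub>k\<close> can be infinite. But \<open>v_opt\<close> is
  lower semicontinuous by compactness of the action sets, and the regions are polytopes as soon
  as a discretization exists; a convex lower semicontinuous function on a polytope is
  continuous, hence uniformly continuous, and the oscillations vanish with the mesh size.
\<close>

section \<open>Lower semicontinuous functions\<close>

text \<open>The filter form turns closure under sums and scaling into arguments about eventual
  inequalities; the set form stays convenient for preimages.\<close>

lemma lsc_on_iff_eventually:
  "lsc_on S g \<longleftrightarrow> (\<forall>x\<in>S. \<forall>a<g x. \<forall>\<^sub>F y in at x within S. a < g y)"
proof
  assume L: "lsc_on S g"
  show "\<forall>x\<in>S. \<forall>a<g x. \<forall>\<^sub>F y in at x within S. a < g y"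
  proof (intro ballI allI impI)
    fix x a assume x: "x \<in> S" "a < g x"
    from L obtain T where T: "open T" "{x \<in> S. a < g x} = S \<inter> T"
      unfolding lsc_on_def openin_open by blast
    with x show "\<forall>\<^sub>F y in at x within S. a < g y"
      unfolding eventually_at_topological by (intro exI[of _ T]) auto
  qed
next
  assume R: "\<forall>x\<in>S. \<forall>a<g x. \<forall>\<^sub>F y in at x within S. a < g y"
  show "lsc_on S g"
    unfolding lsc_on_def
  proof
    fix a
    show "openin (top_of_set S) {x \<in> S. a < g x}"
    proof (subst openin_subopen, intro ballI)
      fix x assume x: "x \<in> {x \<in> S. a < g x}"
      with R have "\<forall>\<^sub>F y in at x within S. a < g y"
        by auto
      then obtain T where "open T" "x \<in> T" "\<forall>y\<in>T. y \<noteq> x \<longrightarrow> y \<in> S \<longrightarrow> a < g y"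
        unfolding eventually_at_topological by blast
      with x show "\<exists>T. openin (top_of_set S) T \<and> x \<in> T \<and> T \<subseteq> {x \<in> S. a < g x}"
        by (intro exI[of _ "S \<inter> T"]) auto
    qed
  qed
qed

lemma lsc_on_subset:
  assumes "lsc_on S g" "T \<subseteq> S"
  shows "lsc_on T g"
  using assms unfolding lsc_on_iff_eventually
  by (meson at_le filter_leD subsetD)

lemma lsc_on_const: "lsc_on S (\<lambda>x. c)"
  by (simp add: lsc_on_iff_eventually)

lemma lsc_on_add:
  assumes "lsc_on S g" "lsc_on S h"
  shows "lsc_on S (\<lambda>x. g x + h x)"
  unfolding lsc_on_iff_eventually
proof (intro ballI allI impI)
  fix x a assume x: "x \<in> S" "a < g x + h x"
  \<comment> \<open>Half of the slack: each summand may drop by \<open>e\<close> before the sum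
    falls to \<open>a\<close>.\<close>
  define e where "e = (g x + h x - a) / 2"
  have "\<forall>\<^sub>F y in at x within S. g x - e < g y" "\<forall>\<^sub>F y in at x within S. h x - e < h y"
    using assms x by (auto simp: lsc_on_iff_eventually e_def)
  then show "\<forall>\<^sub>F y in at x within S. a < g y + h y"
    by eventually_elim (simp add: e_def field_simps)
qed

lemma lsc_on_mult_left:
  assumes "lsc_on S g" "0 \<le> (c::real)"
  shows "lsc_on S (\<lambda>x. c * g x)"
proof (cases "c = 0")
  case False
  with assms(2) have "c > 0" by simp
  then have "(a < c * z) = (a / c < z)" for a z
    by (simp add: field_simps)
  with assms(1) show ?thesis
    unfolding lsc_on_iff_eventually by simp
qed (simp add: lsc_on_const)

lemma lsc_on_sum:
  assumes "\<And>i. i \<in> I \<Longrightarrow> lsc_on S (g i)"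
  shows "lsc_on S (\<lambda>x. \<Sum>i\<in>I. g i x)"
  using assms
  by (induction I rule: infinite_finite_induct) (auto intro: lsc_on_const lsc_on_add)

lemma lsc_on_compose:
  assumes g: "lsc_on T g" and f: "continuous_on S f" "f ` S \<subseteq> T"
  shows "lsc_on S (\<lambda>x. g (f x))"
  unfolding lsc_on_def
proof
  fix a
  have "openin (top_of_set S) (S \<inter> f -` {y \<in> T. a < g y})"
    using g f unfolding lsc_on_def by (intro continuous_openin_preimage[of _ _ T]) auto
  also have "S \<inter> f -` {y \<in> T. a < g y} = {x \<in> S. a < g (f x)}"
    using f(2) by auto
  finally show "openin (top_of_set S) {x \<in> S. a < g (f x)}" .
qed

section \<open>Minimization over compact-valued multifunctions\<close>

lemma usc_multifunction_subset:
  assumes "usc_multifunction S F" "T \<subseteq> S"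
  shows "usc_multifunction T F"
  unfolding usc_multifunction_def
proof (intro allI impI)
  fix V :: "'b set" assume "open V"
  with assms(1) have "openin (top_of_set S) {x \<in> S. F x \<subseteq> V}"
    by (simp add: usc_multifunction_def)
  then obtain W where W: "open W" "{x \<in> S. F x \<subseteq> V} = S \<inter> W"
    unfolding openin_open by blast
  have "{x \<in> T. F x \<subseteq> V} = T \<inter> W"
    using W(2) assms(2) by blast
  with W(1) show "openin (top_of_set T) {x \<in> T. F x \<subseteq> V}"
    by auto
qed

text \<open>The semicontinuous half of Berge's maximum theorem, by a tube argument. Finitely many
  boxes on which \<open>g\<close> exceeds a level \<open>b\<close> cover the compact fibre over
  \<open>x\<close>; upper semicontinuity keeps the fibres over nearby points inside the cover, so
  \<open>g\<close> exceeds \<open>b\<close> there too.\<close>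

lemma lsc_on_INF:
  fixes g :: "'a::topological_space \<Rightarrow> 'b::topological_space \<Rightarrow> real"
  assumes usc: "usc_multifunction S F"
    and F: "\<And>x. x \<in> S \<Longrightarrow> compact (F x)" "\<And>x. x \<in> S \<Longrightarrow> F x \<noteq> {}"
    and g: "lsc_on (Sigma S F) (\<lambda>(x, u). g x u)"
    and bdd: "\<And>x. x \<in> S \<Longrightarrow> bdd_below (g x ` F x)"
  shows "lsc_on S (\<lambda>x. INF u\<in>F x. g x u)"
  unfolding lsc_on_iff_eventually
proof (intro ballI allI impI)
  fix x a assume x: "x \<in> S" "a < (INF u\<in>F x. g x u)"
  \<comment> \<open>A strict pointwise bound by \<open>b\<close> only gives a weak bound on the
    infimum over \<open>F y\<close>; the gap between \<open>a\<close> and \<open>b\<close> restores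
    strictness.\<close>
  then obtain b where b: "a < b" "b < (INF u\<in>F x. g x u)"
    using dense by blast
  from g have "openin (top_of_set (Sigma S F)) {p \<in> Sigma S F. b < (\<lambda>(x, u). g x u) p}"
    by (simp only: lsc_on_def)
  then obtain W where W: "open W" "{p \<in> Sigma S F. b < (\<lambda>(x, u). g x u) p} = Sigma S F \<inter> W"
    by (auto simp only: openin_open)
  have W_iff: "(y, u) \<in> W \<longleftrightarrow> b < g y u" if "y \<in> S" "u \<in> F y" for y u
    using that arg_cong[OF W(2), of "\<lambda>A. (y, u) \<in> A"] by simp
  have "\<exists>A B. open A \<and> open B \<and> x \<in> A \<and> u \<in> B \<and> A \<times> B \<subseteq> W" if u: "u \<in> F x" for u
  proof -
    have "b < g x u"
      using b(2) cINF_lower[OF bdd[OF x(1)] u] by linarith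
    then have "(x, u) \<in> W"
      using W_iff x(1) u by blast
    then obtain A B where "open A" "open B" "(x, u) \<in> A \<times> B" "A \<times> B \<subseteq> W"
      using open_prod_elim[OF W(1)] by metis
    then show ?thesis by blast
  qed
  then obtain A B where AB: "\<And>u. u \<in> F x \<Longrightarrow>
      open (A u) \<and> open (B u) \<and> x \<in> A u \<and> u \<in> B u \<and> A u \<times> B u \<subseteq> W"
    by metis
  obtain D where D: "D \<subseteq> F x" "finite D" "F x \<subseteq> (\<Union>u\<in>D. B u)"
    by (rule compactE_image[OF F(1)[OF x(1)], of "F x" B]) (use AB in auto)
  have "open (\<Union>u\<in>D. B u)"
    using AB D(1) by blast
  then have "openin (top_of_set S) {y \<in> S. F y \<subseteq> (\<Union>u\<in>D. B u)}"
    using usc unfolding usc_multifunction_def by blast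
  then obtain T where T: "open T" "{y \<in> S. F y \<subseteq> (\<Union>u\<in>D. B u)} = S \<inter> T"
    unfolding openin_open by blast
  have "a < (INF u\<in>F y. g y u)" if y: "y \<in> S" "y \<in> T" "y \<in> (\<Inter>u\<in>D. A u)" for y
  proof -
    have "b \<le> g y u" if u: "u \<in> F y" for u
    proof -
      have "F y \<subseteq> (\<Union>u\<in>D. B u)" using T(2) y by blast
      then obtain u' where "u' \<in> D" "u \<in> B u'" using u by blast
      then have "(y, u) \<in> W" using AB D(1) y(3) by blast
      then show ?thesis using W_iff y(1) u by fastforce
    qed
    then have "b \<le> (INF u\<in>F y. g y u)"
      using F(2)[OF y(1)] by (intro cINF_greatest) auto
    with b(1) show ?thesis by simp
  qed
  moreover have "open (T \<inter> (\<Inter>u\<in>D. A u))"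
    using T(1) AB D by (intro open_Int open_INT) auto
  moreover have "x \<in> T \<inter> (\<Inter>u\<in>D. A u)"
    using T(2) D x(1) AB by blast
  ultimately show "\<forall>\<^sub>F y in at x within S. a < (INF u\<in>F y. g y u)"
    unfolding eventually_at_topological
    by (intro exI[of _ "T \<inter> (\<Inter>u\<in>D. A u)"]) auto
qed


section \<open>Convex functions on polytopes\<close>

text \<open>Near \<open>x\<close> a polyhedron agrees with a cone with apex \<open>x\<close>. Of the
  finitely many defining inequalities, those tight at \<open>x\<close> survive every dilation from
  \<open>x\<close>, and those strict at \<open>x\<close> survive by continuity when \<open>y\<close>
  is close.\<close>

lemma polyhedron_eventually_dilate:
  fixes P :: "'a::euclidean_space set"
  assumes P: "polyhedron P" and x: "x \<in> P" and c: "0 < c"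
  shows "\<forall>\<^sub>F y in at x within P. x + c *\<^sub>R (y - x) \<in> P"
proof -
  from P obtain \<H> where \<H>: "finite \<H>" "P = \<Inter>\<H>"
    "\<forall>h\<in>\<H>. \<exists>a b. a \<noteq> 0 \<and> h = {z. a \<bullet> z \<le> b}"
    unfolding polyhedron_def by metis
  have "\<forall>\<^sub>F y in at x within P. x + c *\<^sub>R (y - x) \<in> h" if h: "h \<in> \<H>" for h
  proof -
    from \<H>(3) h obtain a b where ab: "h = {z. a \<bullet> z \<le> b}" by metis
    from x \<H>(2) h ab have "a \<bullet> x \<le> b" by auto
    then consider "a \<bullet> x = b" | "a \<bullet> x < b" by linarith
    then show ?thesis
    proof cases
      case 1
      have "x + c *\<^sub>R (y - x) \<in> h" if "y \<in> P" for y
      proof -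
        from that \<H>(2) h ab have "a \<bullet> y \<le> b" by auto
        then have "c * (a \<bullet> y - b) \<le> 0"
          using c by (simp add: mult_nonneg_nonpos)
        then show ?thesis
          by (simp add: ab 1 inner_add_right inner_diff_right)
      qed
      then show ?thesis
        by (auto simp: eventually_at_topological intro: exI[of _ UNIV])
    next
      case 2
      have "((\<lambda>y. a \<bullet> (x + c *\<^sub>R (y - x))) \<longlongrightarrow> a \<bullet> (x + c *\<^sub>R (x - x))) (at x within P)"
        by (intro tendsto_intros)
      then have "\<forall>\<^sub>F y in at x within P. a \<bullet> (x + c *\<^sub>R (y - x)) < b"
        using 2 by (intro order_tendstoD) auto
      then show ?thesis
        by eventually_elim (simp add: ab)
    qed
  qed
  then have "\<forall>\<^sub>F y in at x within P. \<forall>h\<in>\<H>. x + c *\<^sub>R (y - x) \<in> h"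
    using \<H>(1) by (simp add: eventually_ball_finite)
  then show ?thesis
    by eventually_elim (simp add: \<H>(2))
qed

lemma convex_on_polytope_bdd_above:
  fixes f :: "'a::euclidean_space \<Rightarrow> real"
  assumes "polytope P" "convex_on P f"
  obtains M where "\<And>x. x \<in> P \<Longrightarrow> f x \<le> M"
proof -
  from assms(1) obtain V where V: "finite V" "P = convex hull V"
    unfolding polytope_def by blast
  \<comment> \<open>The inserted 0 keeps the maximum meaningful when \<open>V\<close> is
    empty.\<close>
  have "f x \<le> Max (insert 0 (f ` V))" if "x \<in> P" for x
    using convex_on_convex_hull_bound[of V f "Max (insert 0 (f ` V))"] assms(2) V that
    by auto
  then show ?thesis using that by blast
qed

text \<open>Upper semicontinuity is the point: a polytope is locally a cone, so a point y near x lies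
  on a segment from x to a point of the polytope with a weight at x close to one.\<close>

lemma convex_lsc_on_polytope_imp_continuous:
  fixes f :: "'a::euclidean_space \<Rightarrow> real"
  assumes P: "polytope P" and f: "convex_on P f" and lsc: "lsc_on P f"
  shows "continuous_on P f"
  unfolding continuous_on_def
proof
  fix x assume x: "x \<in> P"
  obtain M0 where M0: "\<And>x. x \<in> P \<Longrightarrow> f x \<le> M0"
    using convex_on_polytope_bdd_above[OF P f] by blast
  \<comment> \<open>Raised strictly above \<open>f x\<close>, so that \<open>M - f x\<close> can
    serve as a divisor.\<close>
  define M where "M = max M0 (f x) + 1"
  have M: "f y \<le> M" if "y \<in> P" for y
    using M0[OF that] by (simp add: M_def)
  have Mx: "f x < M" by (simp add: M_def)
  show "(f \<longlongrightarrow> f x) (at x within P)"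
  proof (rule order_tendstoI)
    fix a assume "a < f x"
    then show "\<forall>\<^sub>F y in at x within P. a < f y"
      using lsc x by (simp add: lsc_on_iff_eventually)
  next
    fix a assume a: "f x < a"
    \<comment> \<open>\<open>l\<close> is the weight of the far endpoint \<open>?z\<close> in
      \<open>y\<close>. It is so small that even the value \<open>M\<close> at \<open>?z\<close>
      raises \<open>f y\<close> by less than \<open>a - f x\<close>; the minimum with 1 keeps it a
      convex weight.\<close>
    define l where "l = min 1 ((a - f x) / (2 * (M - f x)))"
    have l: "0 < l" "l \<le> 1"
      using a Mx by (auto simp: l_def)
    have "l \<le> (a - f x) / (2 * (M - f x))" by (simp add: l_def)
    then have "l * (M - f x) \<le> (a - f x) / 2"
      using Mx by (simp add: field_simps)
    also have "\<dots> < a - f x" using a by simp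
    finally have la: "l * (M - f x) < a - f x" .
    have "\<forall>\<^sub>F y in at x within P. x + (1 / l) *\<^sub>R (y - x) \<in> P"
      using l(1) by (intro polyhedron_eventually_dilate polytope_imp_polyhedron[OF P] x) simp
    then show "\<forall>\<^sub>F y in at x within P. f y < a"
    proof eventually_elim
      case (elim y)
      let ?z = "x + (1 / l) *\<^sub>R (y - x)"
      have "y = (1 - l) *\<^sub>R x + l *\<^sub>R ?z"
        using l by (simp add: algebra_simps)
      then have "f y \<le> (1 - l) * f x + l * f ?z"
        using convex_onD[OF f, of l x ?z] l x elim by simp
      also have "\<dots> \<le> (1 - l) * f x + l * M"
        using M[OF elim] l by simp
      also have "\<dots> < a" using la by (simp add: algebra_simps)
      finally show ?case .
    qed
  qed
qed

text \<open>The weights are indexed by \<open>I\<close> instead of by points, as the approximate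
  operator requires. Since \<open>p\<close> may repeat points, all weight is put on a subset
  \<open>U\<close> on which \<open>p\<close> is injective with the same image.\<close>

lemma in_convex_hull_imageE:
  fixes p :: "'i \<Rightarrow> 'a::real_vector"
  assumes y: "y \<in> convex hull (p ` I)" and I: "finite I"
  obtains \<gamma> where "\<forall>i. 0 \<le> \<gamma> i" "\<forall>i. i \<notin> I \<longrightarrow> \<gamma> i = (0::real)"
    "sum \<gamma> I = 1" "(\<Sum>i\<in>I. \<gamma> i *\<^sub>R p i) = y"
proof -
  obtain U where U: "U \<subseteq> I" "inj_on p U" "p ` I = p ` U"
    using subset_image_inj[of "p ` I" p I] by blast
  have "finite U" using U(1) I finite_subset by blast
  obtain \<mu> where \<mu>: "\<forall>z\<in>p ` U. 0 \<le> \<mu> z" "sum \<mu> (p ` U) = 1" "(\<Sum>z\<in>p ` U. \<mu> z *\<^sub>R z) = y"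
    using y \<open>finite U\<close> unfolding U(3) by (auto simp: convex_hull_finite)
  define \<gamma> where "\<gamma> = (\<lambda>i. if i \<in> U then \<mu> (p i) else 0)"
  have "sum \<gamma> I = (\<Sum>i\<in>U. \<mu> (p i))"
    using U(1) I by (intro sum.mono_neutral_cong_right) (auto simp: \<gamma>_def)
  also have "\<dots> = 1"
    using \<mu>(2) by (simp add: sum.reindex[OF U(2)])
  finally have 1: "sum \<gamma> I = 1" .
  have "(\<Sum>i\<in>I. \<gamma> i *\<^sub>R p i) = (\<Sum>i\<in>U. \<mu> (p i) *\<^sub>R p i)"
    using U(1) I by (intro sum.mono_neutral_cong_right) (auto simp: \<gamma>_def)
  also have "\<dots> = y"
    using \<mu>(3) by (simp add: sum.reindex[OF U(2)])
  finally have 2: "(\<Sum>i\<in>I. \<gamma> i *\<^sub>R p i) = y" .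
  show thesis
    using 1 2 by (rule that[rotated 2]) (use U(1) \<mu>(1) in \<open>auto simp: \<gamma>_def\<close>)
qed


section \<open>The optimal value function\<close>

text \<open>The common one-step expression of the recursions for \<open>v_opt\<close> and
  \<open>v_policy\<close>, which lets both be compared through monotonicity in
  \<open>v\<close>.\<close>

definition q_value ::
    "('n::finite, 'm::finite, 'l::finite, 'w) control_problem \<Rightarrow> (real ^ 'n \<Rightarrow> real) \<Rightarrow>
     real ^ 'n \<Rightarrow> real ^ 'm \<Rightarrow> real" where
  "q_value m v x u = stage_cost m x u
     + (\<Sum>s=1..num_scenarios m. scenario_prob m s * v (dynamics m x u (scenario m s)))"

lemma v_opt_less: "t < horizon m \<Longrightarrow>
    v_opt m t x = (INF u\<in>admissible m x. q_value m (v_opt m (Suc t)) x u)"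
  by (subst v_opt.simps) (simp add: bellman_def q_value_def)

lemma v_opt_horizon: "v_opt m (horizon m) = terminal_cost m"
  by (subst v_opt.simps) simp

lemma v_policy_less: "t < horizon m \<Longrightarrow>
    v_policy m \<pi> t x = q_value m (v_policy m \<pi> (Suc t)) x (\<pi> t x)"
  by (subst v_policy.simps) (simp add: q_value_def)

lemma v_policy_horizon: "v_policy m \<pi> (horizon m) = terminal_cost m"
  by (subst v_policy.simps) simp

lemma v_hat_less: "t < horizon m \<Longrightarrow>
    v_hat m d t x = approx_operator m d t (v_hat m d (Suc t)) x"
  by (subst v_hat.simps) simp

lemma v_hat_horizon: "v_hat m d (horizon m) = terminal_cost m"
  by (subst v_hat.simps) simp

lemma scenario_prob_nonneg: "0 \<le> scenario_prob m s"
  by (simp add: scenario_prob_def)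

lemma state_regions_mono:
  assumes "state_regions m Z" "s \<le> t" "t \<le> horizon m"
  shows "Z s \<subseteq> Z t"
  using assms(2,3,1)
proof (induction t rule: dec_induct)
  case (step t)
  then have "Z t \<subseteq> Z (Suc t)" by (simp add: state_regions_def)
  with step show ?case by auto
qed simp

section \<open>Bounds and semicontinuity by backward induction over the regions\<close>

locale semicontinuous_control =
  fixes m :: "('n::finite, 'm::finite, 'l::finite, 'w) control_problem"
    and Z :: "nat \<Rightarrow> (real ^ 'n) set"
  assumes model: "semicontinuous_model m"
    and regions: "state_regions m Z"
begin

lemma sum_scenario_prob: "(\<Sum>s=1..num_scenarios m. scenario_prob m s) = 1"
  using model by (simp add: semicontinuous_model_def)

lemma Z_subset_states: "t \<le> horizon m \<Longrightarrow> Z t \<subseteq> states m"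
  using state_regions_mono[OF regions, of t "horizon m"] regions
  by (auto simp: state_regions_def)

lemma admissible_nonempty: "t \<le> horizon m \<Longrightarrow> x \<in> Z t \<Longrightarrow> admissible m x \<noteq> {}"
  using model Z_subset_states
  by (auto simp: semicontinuous_model_def control_model_def)

lemma dynamics_in_Z:
  assumes "t < horizon m" "x \<in> Z t" "u \<in> admissible m x" "s \<in> {1..num_scenarios m}"
  shows "dynamics m x u (scenario m s) \<in> Z (Suc t)"
proof -
  have "scenario m s \<in> disturbances m"
    using model assms(4) by (auto simp: semicontinuous_model_def)
  with regions assms(1-3) show ?thesis by (auto simp: state_regions_def)
qed

lemma q_value_mono:
  assumes "t < horizon m" "x \<in> Z t" "u \<in> admissible m x"
    and "\<And>y. y \<in> Z (Suc t) \<Longrightarrow> v y \<le> v' y"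
  shows "q_value m v x u \<le> q_value m v' x u"
  unfolding q_value_def
  by (intro add_mono order_refl sum_mono mult_left_mono assms(4) dynamics_in_Z[OF assms(1-3)]
      scenario_prob_nonneg)

text \<open>The weight \<open>w\<close> is continuous, hence bounded on the compact final region,
  and it dominates both costs. The final region suffices because it contains all the others.\<close>

lemma costs_bounded_below:
  obtains C where "\<And>x u. x \<in> Z (horizon m) \<Longrightarrow> u \<in> admissible m x \<Longrightarrow> C \<le> stage_cost m x u"
    and "\<And>x. x \<in> Z (horizon m) \<Longrightarrow> C \<le> terminal_cost m x"
proof -
  let ?Z = "Z (horizon m)"
  from model obtain rbar qbar \<beta> w where nonneg: "0 \<le> rbar" "0 \<le> qbar"
    and w: "continuous_on (states m) w"
    and bnd: "\<forall>(x, u)\<in>admissible_pairs m.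
           \<bar>stage_cost m x u\<bar> \<le> rbar * w x \<and>
           \<bar>terminal_cost m x\<bar> \<le> qbar * w x \<and>
           (\<integral>\<omega>. w (dynamics m x u (disturbance m \<omega>)) \<partial>sample_space m) \<le> \<beta> * w x"
    unfolding semicontinuous_model_def by (elim conjE exE) (rule that)
  have "compact ?Z"
    using regions by (simp add: state_regions_def)
  moreover have "continuous_on ?Z w"
    using w Z_subset_states by (rule continuous_on_subset) simp
  ultimately have "bounded (w ` ?Z)"
    by (intro compact_imp_bounded compact_continuous_image)
  then obtain W where W: "\<And>x. x \<in> ?Z \<Longrightarrow> \<bar>w x\<bar> \<le> W"
    unfolding bounded_iff by auto
  have pair: "\<bar>stage_cost m x u\<bar> \<le> rbar * W \<and> \<bar>terminal_cost m x\<bar> \<le> qbar * W"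
    if "x \<in> ?Z" "u \<in> admissible m x" for x u
  proof -
    have "(x, u) \<in> admissible_pairs m"
      using that Z_subset_states[OF order_refl] by (auto simp: admissible_pairs_def)
    with bnd have "\<bar>stage_cost m x u\<bar> \<le> rbar * w x" "\<bar>terminal_cost m x\<bar> \<le> qbar * w x"
      by auto
    moreover have "rbar * w x \<le> rbar * W" "qbar * w x \<le> qbar * W"
      using W[OF that(1)] nonneg by (auto intro: mult_left_mono)
    ultimately show ?thesis by linarith
  qed
  show thesis
  proof
    fix x u assume "x \<in> ?Z" "u \<in> admissible m x"
    with pair show "min (- (rbar * W)) (- (qbar * W)) \<le> stage_cost m x u" by fastforce
  next
    fix x assume x: "x \<in> ?Z"
    \<comment> \<open>The growth condition speaks of admissible pairs, so even the terminal cost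
      needs an action as witness.\<close>
    then obtain u where "u \<in> admissible m x" using admissible_nonempty by blast
    with pair x show "min (- (rbar * W)) (- (qbar * W)) \<le> terminal_cost m x" by fastforce
  qed
qed

lemma q_value_bounded_below:
  assumes "t < horizon m" and B: "\<And>y. y \<in> Z (Suc t) \<Longrightarrow> B \<le> v y"
  obtains C where "\<And>x u. x \<in> Z t \<Longrightarrow> u \<in> admissible m x \<Longrightarrow> C \<le> q_value m v x u"
proof -
  obtain C where C: "\<And>x u. x \<in> Z (horizon m) \<Longrightarrow> u \<in> admissible m x \<Longrightarrow> C \<le> stage_cost m x u"
    using costs_bounded_below by metis
  have "C + B \<le> q_value m v x u" if x: "x \<in> Z t" "u \<in> admissible m x" for x u
  proof -
    \<comment> \<open>The probabilities sum to one, so the expectation of the constant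
      \<open>B\<close> is \<open>B\<close> itself.\<close>
    have "C + B \<le> q_value m (\<lambda>_. B) x u"
      using C[of x u] x assms(1) state_regions_mono[OF regions, of t "horizon m"] sum_scenario_prob
      by (auto simp: q_value_def simp flip: sum_distrib_right)
    also have "\<dots> \<le> q_value m v x u"
      by (rule q_value_mono[OF assms(1) x]) (rule B)
    finally show ?thesis .
  qed
  then show thesis using that by blast
qed

text \<open>Ensures that the real infima in the Bellman recursion are genuine lower bounds of the
  values they range over.\<close>

lemma v_opt_bounded_below: "t \<le> horizon m \<Longrightarrow> \<exists>B. \<forall>x\<in>Z t. B \<le> v_opt m t x"
proof (induction t rule: inc_induct)
  case base
  show ?case using costs_bounded_below v_opt_horizon by metis
next
  case (step t)
  then obtain B where "\<And>y. y \<in> Z (Suc t) \<Longrightarrow> B \<le> v_opt m (Suc t) y" by blast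
  then obtain C where C: "\<And>x u. x \<in> Z t \<Longrightarrow> u \<in> admissible m x \<Longrightarrow>
      C \<le> q_value m (v_opt m (Suc t)) x u"
    using q_value_bounded_below[of t B "v_opt m (Suc t)"] step.hyps by blast
  have "C \<le> v_opt m t x" if "x \<in> Z t" for x
    unfolding v_opt_less[OF \<open>t < horizon m\<close>]
    using that step.hyps admissible_nonempty[of t x] by (intro cINF_greatest C) auto
  then show ?case by blast
qed

lemma bdd_below_q_value:
  assumes "t < horizon m" "x \<in> Z t"
  shows "bdd_below (q_value m (v_opt m (Suc t)) x ` admissible m x)"
proof -
  obtain B where "\<And>y. y \<in> Z (Suc t) \<Longrightarrow> B \<le> v_opt m (Suc t) y"
    using v_opt_bounded_below[of "Suc t"] assms(1) by auto
  then obtain C where "\<And>x u. x \<in> Z t \<Longrightarrow> u \<in> admissible m x \<Longrightarrow>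
      C \<le> q_value m (v_opt m (Suc t)) x u"
    using q_value_bounded_below[of t B "v_opt m (Suc t)"] assms(1) by blast
  with assms(2) show ?thesis by (intro bdd_belowI2)
qed

lemma v_opt_le_q_value:
  assumes "t < horizon m" "x \<in> Z t" "u \<in> admissible m x"
  shows "v_opt m t x \<le> q_value m (v_opt m (Suc t)) x u"
  unfolding v_opt_less[OF assms(1)] by (rule cINF_lower[OF bdd_below_q_value assms(3)]) fact+

lemma v_opt_le_v_policy:
  assumes \<pi>: "\<And>t x. t < horizon m \<Longrightarrow> x \<in> Z t \<Longrightarrow> \<pi> t x \<in> admissible m x"
  shows "t \<le> horizon m \<Longrightarrow> x \<in> Z t \<Longrightarrow> v_opt m t x \<le> v_policy m \<pi> t x"
proof (induction t arbitrary: x rule: inc_induct)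
  case base
  show ?case by (simp add: v_opt_horizon v_policy_horizon)
next
  case (step t)
  have "v_opt m t x \<le> q_value m (v_opt m (Suc t)) x (\<pi> t x)"
    using step \<pi> by (intro v_opt_le_q_value)
  also have "\<dots> \<le> v_policy m \<pi> t x"
    unfolding v_policy_less[OF \<open>t < horizon m\<close>]
    using step \<pi> by (intro q_value_mono[of t])
  finally show ?case .
qed

text \<open>Continuous dynamics and nonnegative probabilities carry semicontinuity from stage
  \<open>Suc t\<close> to the one-step value on the graph of admissible pairs;
  \<open>lsc_on_INF\<close> carries it through the minimization.\<close>

lemma lsc_on_v_opt: "t \<le> horizon m \<Longrightarrow> lsc_on (Z t) (v_opt m t)"
proof (induction t rule: inc_induct)
  case base
  have "lsc_on (states m) (terminal_cost m)"
    using model by (simp add: semicontinuous_model_def)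
  then show ?case
    unfolding v_opt_horizon by (rule lsc_on_subset) (simp add: Z_subset_states)
next
  case (step t)
  let ?G = "Sigma (Z t) (admissible m)"
  have Z: "Z t \<subseteq> states m" using step.hyps by (simp add: Z_subset_states)
  then have sub: "?G \<subseteq> admissible_pairs m"
    by (auto simp: admissible_pairs_def)
  have "lsc_on ?G (\<lambda>(x, u). stage_cost m x u)"
    using model sub by (auto simp: semicontinuous_model_def intro: lsc_on_subset)
  moreover have "lsc_on ?G (\<lambda>p. scenario_prob m s *
      v_opt m (Suc t) ((\<lambda>(x, u). dynamics m x u (scenario m s)) p))"
    if s: "s \<in> {1..num_scenarios m}" for s
  proof (intro lsc_on_mult_left lsc_on_compose[OF step.IH] scenario_prob_nonneg)
    have "scenario m s \<in> disturbances m"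
      using model s by (auto simp: semicontinuous_model_def)
    then have "continuous_on (admissible_pairs m) (\<lambda>(x, u). dynamics m x u (scenario m s))"
      using model by (simp add: semicontinuous_model_def)
    then show "continuous_on ?G (\<lambda>(x, u). dynamics m x u (scenario m s))"
      using sub by (rule continuous_on_subset)
    show "(\<lambda>(x, u). dynamics m x u (scenario m s)) ` ?G \<subseteq> Z (Suc t)"
      using dynamics_in_Z[OF \<open>t < horizon m\<close> _ _ s] by auto
  qed
  ultimately have "lsc_on ?G (\<lambda>p. (\<lambda>(x, u). stage_cost m x u) p + (\<Sum>s=1..num_scenarios m.
      scenario_prob m s * v_opt m (Suc t) ((\<lambda>(x, u). dynamics m x u (scenario m s)) p)))"
    by (intro lsc_on_add lsc_on_sum)
  then have lsc: "lsc_on ?G (\<lambda>(x, u). q_value m (v_opt m (Suc t)) x u)"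
    by (simp add: q_value_def case_prod_unfold)
  have "lsc_on (Z t) (\<lambda>x. INF u\<in>admissible m x. q_value m (v_opt m (Suc t)) x u)"
  proof (rule lsc_on_INF[OF _ _ _ lsc])
    show "usc_multifunction (Z t) (admissible m)"
      using model Z by (auto simp: semicontinuous_model_def intro: usc_multifunction_subset)
    show "compact (admissible m x)" if "x \<in> Z t" for x
      using that model Z by (auto simp: semicontinuous_model_def)
    show "admissible m x \<noteq> {}" if "x \<in> Z t" for x
      using that step.hyps by (intro admissible_nonempty[of t]) auto
    show "bdd_below (q_value m (v_opt m (Suc t)) x ` admissible m x)" if "x \<in> Z t" for x
      using that step.hyps by (intro bdd_below_q_value)
  qed
  then show ?case
    by (simp add: v_opt_less[OF \<open>t < horizon m\<close>, abs_def])
qed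

end


section \<open>Discretizations\<close>

lemma
  assumes "discretization m Z d" "s \<le> t" "t \<le> horizon m"
  shows num_cells_mono: "num_cells d s \<le> num_cells d t"
    and num_nodes_mono: "num_nodes d s \<le> num_nodes d t"
  using assms(2,3,1)
proof (induction t rule: dec_induct)
  case (step t)
  { case 1
    with step have "num_cells d t \<le> num_cells d (Suc t)" by (simp add: discretization_def Let_def)
    with 1 step show ?case by simp }
  { case 2
    with step have "num_nodes d t \<le> num_nodes d (Suc t)" by (simp add: discretization_def Let_def)
    with 2 step show ?case by simp }
qed simp_all

lemma node_in_Z:
  assumes d: "discretization m Z d" and k: "k \<le> horizon m" and i: "i \<in> {1..num_nodes d k}"
  shows "node d i \<in> Z k"
  using num_nodes_mono[OF d k order_refl] d i k by (auto simp: discretization_def Let_def)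

lemma cell_eq_hull:
  assumes d: "discretization m Z d" and j: "j \<in> {1..num_cells d (horizon m)}"
  obtains I where "I \<subseteq> {1..num_nodes d (horizon m)}" "cell d j = convex hull (node d ` I)"
proof -
  have "\<exists>I\<subseteq>{1..num_nodes d (horizon m)}. cell d j = convex hull (node d ` I)"
    using d j unfolding discretization_def Let_def by blast
  then show thesis using that by blast
qed

text \<open>The cells covering the region are hulls of finitely many nodes each; convexity of the
  region makes it the hull of all these nodes together.\<close>

lemma Z_polytope:
  assumes d: "discretization m Z d" and k: "k \<le> horizon m" and conv: "convex (Z k)"
  shows "polytope (Z k)"
proof -
  let ?J = "{1..num_cells d k}"
  have Z: "(\<Union>j\<in>?J. cell d j) = Z k"
    using d k by (simp add: discretization_def Let_def)
  have "\<exists>V. finite V \<and> cell d j = convex hull V" if "j \<in> ?J" for j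
  proof -
    have "j \<in> {1..num_cells d (horizon m)}"
      using that num_cells_mono[OF d k order_refl] by simp
    then obtain I where "I \<subseteq> {1..num_nodes d (horizon m)}" "cell d j = convex hull (node d ` I)"
      by (rule cell_eq_hull[OF d])
    then show ?thesis by (metis finite_atLeastAtMost finite_imageI finite_subset)
  qed
  then obtain V where V: "\<And>j. j \<in> ?J \<Longrightarrow> finite (V j)" "\<And>j. j \<in> ?J \<Longrightarrow> cell d j = convex hull (V j)"
    by metis
  have "Z k = convex hull (\<Union>j\<in>?J. V j)"
  proof
    show "Z k \<subseteq> convex hull (\<Union>j\<in>?J. V j)"
    proof -
      have "cell d j \<subseteq> convex hull (\<Union>j\<in>?J. V j)" if "j \<in> ?J" for j
        unfolding V(2)[OF that] using that by (intro hull_mono) blast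
      then show ?thesis unfolding Z[symmetric] by blast
    qed
    have "V j \<subseteq> Z k" if "j \<in> ?J" for j
      using V(2)[OF that] hull_subset[of "V j" convex] that Z by blast
    then show "convex hull (\<Union>j\<in>?J. V j) \<subseteq> Z k"
      by (intro hull_minimal conv) blast
  qed
  then show ?thesis
    unfolding polytope_def using V(1) by blast
qed

text \<open>The mesh size compares nodes only, but a ball around a node is convex: containing the
  nodes that span the cell, it contains the whole cell.\<close>

lemma norm_node_diff_le_mesh:
  assumes d: "discretization m Z d" and k: "k \<le> horizon m" and j: "j \<in> {1..num_cells d k}"
    and i: "i \<in> {1..num_nodes d k}" "node d i \<in> cell d j" and y: "y \<in> cell d j"
  shows "norm (node d i - y) \<le> mesh m d"
proof -
  let ?K = "horizon m"
  have jK: "j \<in> {1..num_cells d ?K}"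
    using j num_cells_mono[OF d k order_refl] by simp
  have iK: "i \<in> {1..num_nodes d ?K}"
    using i num_nodes_mono[OF d k order_refl] by simp
  obtain I where I: "I \<subseteq> {1..num_nodes d ?K}" "cell d j = convex hull (node d ` I)"
    by (rule cell_eq_hull[OF d jK])
  let ?S = "{norm (node d i - node d j) | k i j. k \<in> {1..num_cells d ?K} \<and>
       i \<in> {1..num_nodes d ?K} \<and> j \<in> {1..num_nodes d ?K} \<and>
       node d i \<in> cell d k \<and> node d j \<in> cell d k}"
  have "?S \<subseteq> (\<lambda>(i, j). norm (node d i - node d j)) ` ({1..num_nodes d ?K} \<times> {1..num_nodes d ?K})"
    by auto
  then have fin: "finite ?S" by (rule finite_subset) simp
  have "node d i' \<in> cball (node d i) (mesh m d)" if "i' \<in> I" for i'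
  proof -
    have "node d i' \<in> cell d j" unfolding I(2) using that by (intro hull_inc) blast
    then have "norm (node d i - node d i') \<in> ?S"
      using jK iK i(2) that I(1) by blast
    then have "norm (node d i - node d i') \<le> mesh m d"
      unfolding mesh_def using fin by (intro Max_ge) auto
    then show ?thesis by (simp add: dist_norm)
  qed
  then have "convex hull (node d ` I) \<subseteq> cball (node d i) (mesh m d)"
    by (intro hull_minimal) auto
  with y I(2) show ?thesis by (auto simp: dist_norm)
qed

text \<open>Supplies the feasible weights for the approximate operator. That nodes of nonzero weight
  share a cell with \<open>y\<close> is what makes the interpolation error an oscillation on one
  cell.\<close>

lemma cell_interpolation:
  assumes d: "discretization m Z d" and k: "k \<le> horizon m" and y: "y \<in> Z k"
  obtains j \<gamma> where "j \<in> {1..num_cells d k}" "y \<in> cell d j"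
    "\<forall>i. 0 \<le> \<gamma> i" "(\<Sum>i=1..num_nodes d k. \<gamma> i) = (1::real)"
    "(\<Sum>i=1..num_nodes d k. \<gamma> i *\<^sub>R node d i) = y"
    "\<forall>i. \<gamma> i \<noteq> 0 \<longrightarrow> node d i \<in> cell d j"
proof -
  have Z: "(\<Union>j\<in>{1..num_cells d k}. cell d j) = Z k"
    using d k by (simp add: discretization_def Let_def)
  then obtain j where j: "j \<in> {1..num_cells d k}" "y \<in> cell d j" using y by blast
  then have "j \<in> {1..num_cells d (horizon m)}"
    using num_cells_mono[OF d k order_refl] by simp
  then obtain I where I: "I \<subseteq> {1..num_nodes d (horizon m)}" "cell d j = convex hull (node d ` I)"
    by (rule cell_eq_hull[OF d])
  have node: "node d i \<in> cell d j" if "i \<in> I" for i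
    unfolding I(2) using that by (intro hull_inc) blast
  \<comment> \<open>The spanning nodes are first known only among all nodes; lying in a cell of
    \<open>Z k\<close>, they are numbered within stage \<open>k\<close>.\<close>
  have "i \<in> {1..num_nodes d k}" if "i \<in> I" for i
  proof -
    have "node d i \<in> Z k" using node[OF that] j(1) Z by blast
    with that I(1) d k show ?thesis by (auto simp: discretization_def Let_def)
  qed
  then have sub: "I \<subseteq> {1..num_nodes d k}" by blast
  then have fin: "finite I" by (rule finite_subset) simp
  obtain \<gamma> where \<gamma>: "\<forall>i. 0 \<le> \<gamma> i" "\<forall>i. i \<notin> I \<longrightarrow> \<gamma> i = (0::real)"
    "sum \<gamma> I = 1" "(\<Sum>i\<in>I. \<gamma> i *\<^sub>R node d i) = y"
    by (rule in_convex_hull_imageE[OF j(2)[unfolded I(2)] fin]) (rule that)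
  have "(\<Sum>i=1..num_nodes d k. \<gamma> i) = sum \<gamma> I"
    "(\<Sum>i=1..num_nodes d k. \<gamma> i *\<^sub>R node d i) = (\<Sum>i\<in>I. \<gamma> i *\<^sub>R node d i)"
    using sub \<gamma>(2) by (auto intro: sum.mono_neutral_right)
  with \<gamma> j node show thesis
    by (intro that[of j \<gamma>]) auto
qed

section \<open>Attained minima and Lipschitz bounds on a cell\<close>

lemma objective_eq:
  "objective m d t v x (u, \<gamma>) = stage_cost m x u
     + (\<Sum>s=1..num_scenarios m. scenario_prob m s * (\<Sum>i=1..num_nodes d (Suc t). \<gamma> s i * v (node d i)))"
  by (simp add: objective_def sum_distrib_left mult.assoc)

text \<open>The policy supplies a minimizer, so the infimum is a minimum and bounds the objective at
  every feasible point without a separate lower bound.\<close>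

lemma approx_policyE:
  assumes "approx_policy m Z d \<pi>" "t < horizon m" "x \<in> Z t"
  obtains \<gamma> where "feasible m d t x (\<pi> t x, \<gamma>)"
    "v_hat m d t x = objective m d t (v_hat m d (Suc t)) x (\<pi> t x, \<gamma>)"
    "\<forall>c. feasible m d t x c \<longrightarrow> v_hat m d t x \<le> objective m d t (v_hat m d (Suc t)) x c"
proof -
  let ?f = "objective m d t (v_hat m d (Suc t)) x"
  from assms obtain \<gamma> where \<gamma>: "is_arg_min ?f (feasible m d t x) (\<pi> t x, \<gamma>)"
    unfolding approx_policy_def by blast
  then have min: "feasible m d t x (\<pi> t x, \<gamma>)" "\<And>c. feasible m d t x c \<Longrightarrow> ?f (\<pi> t x, \<gamma>) \<le> ?f c"
    unfolding is_arg_min_def by (auto simp: not_less)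
  have "v_hat m d t x = ?f (\<pi> t x, \<gamma>)"
    unfolding v_hat_less[OF assms(2)] approx_operator_def
    by (rule cInf_eq_minimum) (use min in auto)
  with min that show thesis by simp
qed

lemma v_opt_diff_le_lipschitz:
  assumes "j \<in> {1..num_cells d k}" "x \<in> cell d j" "y \<in> cell d j" "norm (x - y) \<le> \<delta>"
  shows "ennreal (v_opt m k x - v_opt m k y) \<le> cell_lipschitz m d k * ennreal \<delta>"
\<comment> \<open>Equal points are excluded from the difference quotients, but their difference
  vanishes.\<close>
proof (cases "x = y")
  case False
  let ?D = "\<bar>v_opt m k x - v_opt m k y\<bar>"
  have "ennreal (v_opt m k x - v_opt m k y) \<le> ennreal ?D"
    by (intro ennreal_leI) simp
  also have "\<dots> = ennreal (?D / norm (x - y)) * ennreal (norm (x - y))"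
    using False by (simp flip: ennreal_mult)
  also have "\<dots> \<le> cell_lipschitz m d k * ennreal \<delta>"
  proof (rule mult_mono)
    show "ennreal (?D / norm (x - y)) \<le> cell_lipschitz m d k"
      unfolding cell_lipschitz_def
      by (rule SUP_upper2[OF assms(1)], rule SUP_upper2[of "(x, y)"]) (use assms False in auto)
  qed (use assms(4) in \<open>auto intro: ennreal_leI\<close>)
  finally show ?thesis .
qed simp

section \<open>Comparison of policy, approximate and optimal values\<close>

context semicontinuous_control
begin

text \<open>The action of the policy comes with optimal weights that represent its image states by
  nodes. Jensen's inequality bounds \<open>v_hat\<close> at those states by the weighted node values
  that enter the minimum.\<close>

lemma v_policy_le_v_hat:
  assumes scheme: "convex_scheme m Z d \<pi>"
  shows "t \<le> horizon m \<Longrightarrow> x \<in> Z t \<Longrightarrow> v_policy m \<pi> t x \<le> v_hat m d t x"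
proof (induction t arbitrary: x rule: inc_induct)
  case base
  show ?case by (simp add: v_hat_horizon v_policy_horizon)
next
  case (step t)
  note t = \<open>t < horizon m\<close>
  let ?v = "v_hat m d (Suc t)" and ?I = "{1..num_nodes d (Suc t)}"
  have d: "discretization m Z d" and pol: "approx_policy m Z d \<pi>"
    and conv: "convex_on (Z (Suc t)) ?v"
    using scheme t by (auto simp: convex_scheme_def)
  obtain \<gamma> where \<gamma>: "feasible m d t x (\<pi> t x, \<gamma>)"
    "v_hat m d t x = objective m d t ?v x (\<pi> t x, \<gamma>)"
    by (rule approx_policyE[OF pol t \<open>x \<in> Z t\<close>]) (rule that)
  then have adm: "\<pi> t x \<in> admissible m x" by (simp add: feasible_def)
  have "?v (dynamics m x (\<pi> t x) (scenario m s)) \<le> (\<Sum>i\<in>?I. \<gamma> s i * ?v (node d i))"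
    if s: "s \<in> {1..num_scenarios m}" for s
  proof -
    have f: "dynamics m x (\<pi> t x) (scenario m s) = (\<Sum>i\<in>?I. \<gamma> s i *\<^sub>R node d i)"
      and sum: "sum (\<gamma> s) ?I = 1" and nonneg: "\<And>i. i \<in> ?I \<Longrightarrow> 0 \<le> \<gamma> s i"
      using \<gamma>(1) s by (auto simp: feasible_def)
    \<comment> \<open>Jensen's inequality is applied over a nonempty index set; weights summing to
      one guarantee it.\<close>
    have "?I \<noteq> {}" using sum by (metis sum.empty zero_neq_one)
    then show ?thesis
      unfolding f using conv sum nonneg node_in_Z[OF d, of "Suc t"] t
      by (intro convex_on_sum) auto
  qed
  then have "q_value m ?v x (\<pi> t x) \<le> v_hat m d t x"
    unfolding \<gamma>(2) objective_eq q_value_def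
    by (intro add_mono order_refl sum_mono mult_left_mono scenario_prob_nonneg)
  moreover have "v_policy m \<pi> t x \<le> q_value m ?v x (\<pi> t x)"
    unfolding v_policy_less[OF t] by (rule q_value_mono[OF t \<open>x \<in> Z t\<close> adm]) (rule step.IH)
  ultimately show ?case by linarith
qed

text \<open>Every action becomes feasible for the approximate operator through cell interpolation,
  at the cost of one oscillation plus the error inherited from the next stage. The separate
  \<open>t0\<close> keeps the oscillation hypothesis fixed while the induction moves
  \<open>t\<close>; it is later instantiated with \<open>t\<close> itself.\<close>

lemma v_hat_le_v_opt:
  assumes d: "discretization m Z d" and pol: "approx_policy m Z d \<pi>"
    and osc: "\<And>k j i y. t0 < k \<Longrightarrow> k \<le> horizon m \<Longrightarrow> j \<in> {1..num_cells d k} \<Longrightarrow>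
      i \<in> {1..num_nodes d k} \<Longrightarrow> node d i \<in> cell d j \<Longrightarrow> y \<in> cell d j \<Longrightarrow>
      v_opt m k (node d i) \<le> v_opt m k y + e k"
  shows "t \<le> horizon m \<Longrightarrow> t0 \<le> t \<Longrightarrow> x \<in> Z t \<Longrightarrow>
    v_hat m d t x \<le> v_opt m t x + (\<Sum>k=t+1..horizon m. e k)"
proof (induction t arbitrary: x rule: inc_induct)
  case base
  show ?case by (simp add: v_hat_horizon v_opt_horizon)
next
  case (step t)
  note t = \<open>t < horizon m\<close> and x = \<open>x \<in> Z t\<close>
  let ?v = "v_hat m d (Suc t)" and ?w = "v_opt m (Suc t)" and ?I = "{1..num_nodes d (Suc t)}"
  let ?S = "{1..num_scenarios m}"
  let ?E = "\<Sum>k=t+1..horizon m. e k"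
  have E: "?E = e (Suc t) + (\<Sum>k=Suc t+1..horizon m. e k)"
    using t by (simp add: sum.atLeast_Suc_atMost)
  have "v_hat m d t x - ?E \<le> q_value m ?w x u" if u: "u \<in> admissible m x" for u
  proof -
    have "\<exists>\<gamma>. (\<forall>i. 0 \<le> \<gamma> i) \<and> (\<Sum>i\<in>?I. \<gamma> i) = 1 \<and>
        (\<Sum>i\<in>?I. \<gamma> i *\<^sub>R node d i) = dynamics m x u (scenario m s) \<and>
        (\<Sum>i\<in>?I. \<gamma> i * ?v (node d i)) \<le> ?w (dynamics m x u (scenario m s)) + ?E"
      if s: "s \<in> ?S" for s
    proof -
      let ?y = "dynamics m x u (scenario m s)"
      obtain j \<gamma> where j: "j \<in> {1..num_cells d (Suc t)}" "?y \<in> cell d j"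
        and \<gamma>: "\<forall>i. 0 \<le> \<gamma> i" "(\<Sum>i\<in>?I. \<gamma> i) = (1::real)" "(\<Sum>i\<in>?I. \<gamma> i *\<^sub>R node d i) = ?y"
        "\<forall>i. \<gamma> i \<noteq> 0 \<longrightarrow> node d i \<in> cell d j"
        by (rule cell_interpolation[OF d Suc_leI[OF t] dynamics_in_Z[OF t x u s]]) (rule that)
      have "\<gamma> i * ?v (node d i) \<le> \<gamma> i * (?w ?y + ?E)" if i: "i \<in> ?I" for i
      proof (cases "\<gamma> i = 0")
        \<comment> \<open>A nonzero weight places the node in the cell of \<open>?y\<close>, where
          the oscillation bound applies.\<close>
        case False
        have "?v (node d i) \<le> ?w (node d i) + (\<Sum>k=Suc t+1..horizon m. e k)"
          using step.IH node_in_Z[OF d _ i] t step.prems by simp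
        moreover have "?w (node d i) \<le> ?w ?y + e (Suc t)"
          using osc[OF _ _ j(1) i _ j(2)] \<gamma>(4) False t step.prems by simp
        ultimately have "?v (node d i) \<le> ?w ?y + ?E"
          unfolding E by linarith
        then show ?thesis using \<gamma>(1) by (intro mult_left_mono) auto
      qed simp
      then have "(\<Sum>i\<in>?I. \<gamma> i * ?v (node d i)) \<le> (\<Sum>i\<in>?I. \<gamma> i * (?w ?y + ?E))"
        by (rule sum_mono)
      also have "\<dots> = ?w ?y + ?E"
        unfolding sum_distrib_right[symmetric] \<gamma>(2) by simp
      finally show ?thesis using \<gamma> by blast
    qed
    then have "\<forall>s\<in>?S. \<exists>\<gamma>. (\<forall>i. 0 \<le> \<gamma> i) \<and> (\<Sum>i\<in>?I. \<gamma> i) = 1 \<and>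
        (\<Sum>i\<in>?I. \<gamma> i *\<^sub>R node d i) = dynamics m x u (scenario m s) \<and>
        (\<Sum>i\<in>?I. \<gamma> i * ?v (node d i)) \<le> ?w (dynamics m x u (scenario m s)) + ?E" ..
    \<comment> \<open>The cell, and hence the weights, depend on the scenario; one choice over all
      scenarios assembles a single feasible pair.\<close>
    from bchoice[OF this] obtain \<gamma> where \<gamma>: "\<forall>s\<in>?S. (\<forall>i. 0 \<le> \<gamma> s i) \<and> (\<Sum>i\<in>?I. \<gamma> s i) = 1 \<and>
        (\<Sum>i\<in>?I. \<gamma> s i *\<^sub>R node d i) = dynamics m x u (scenario m s) \<and>
        (\<Sum>i\<in>?I. \<gamma> s i * ?v (node d i)) \<le> ?w (dynamics m x u (scenario m s)) + ?E"
      by (rule exE)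
    have "feasible m d t x (u, \<gamma>)"
      using \<gamma> u by (simp add: feasible_def)
    then have "v_hat m d t x \<le> objective m d t ?v x (u, \<gamma>)"
      by - (rule approx_policyE[OF pol t x], blast)
    also have "\<dots> \<le> stage_cost m x u + (\<Sum>s\<in>?S. scenario_prob m s *
        (?w (dynamics m x u (scenario m s)) + ?E))"
      unfolding objective_eq
      using \<gamma> by (intro add_mono order_refl sum_mono mult_left_mono scenario_prob_nonneg) simp
    also have "\<dots> = q_value m ?w x u + ?E"
      unfolding q_value_def distrib_left sum.distrib sum_distrib_right[symmetric] sum_scenario_prob
      by simp
    finally show ?thesis by simp
  qed
  then have "v_hat m d t x - ?E \<le> v_opt m t x"
    unfolding v_opt_less[OF t]
    using admissible_nonempty[OF _ x] t by (intro cINF_greatest) auto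
  then show ?case by simp
qed

text \<open>The chain \<open>v_opt <= v_policy <= v_hat <= v_opt\<close> plus errors. The errors
  \<open>e\<close> stay free, to be taken as Lipschitz bounds for the estimate and as a small
  constant for convergence.\<close>

lemma policy_gap:
  assumes scheme: "convex_scheme m Z d \<pi>"
    and t: "t \<le> horizon m" and x: "x \<in> Z t"
  shows policy_gap_nonneg: "0 \<le> v_policy m \<pi> t x - v_opt m t x"
    and policy_gap_le: "(\<And>k j i y. t < k \<Longrightarrow> k \<le> horizon m \<Longrightarrow> j \<in> {1..num_cells d k} \<Longrightarrow>
      i \<in> {1..num_nodes d k} \<Longrightarrow> node d i \<in> cell d j \<Longrightarrow> y \<in> cell d j \<Longrightarrow>
      v_opt m k (node d i) \<le> v_opt m k y + e k) \<Longrightarrow>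
    v_policy m \<pi> t x - v_opt m t x \<le> (\<Sum>k=t+1..horizon m. e k)"
proof -
  have d: "discretization m Z d" and pol: "approx_policy m Z d \<pi>"
    using scheme by (auto simp: convex_scheme_def)
  have "\<pi> t x \<in> admissible m x" if "t < horizon m" "x \<in> Z t" for t x
    by (rule approx_policyE[OF pol that]) (simp add: feasible_def)
  then show "0 \<le> v_policy m \<pi> t x - v_opt m t x"
    using v_opt_le_v_policy[OF _ t x] by simp
  show "v_policy m \<pi> t x - v_opt m t x \<le> (\<Sum>k=t+1..horizon m. e k)"
    if "\<And>k j i y. t < k \<Longrightarrow> k \<le> horizon m \<Longrightarrow> j \<in> {1..num_cells d k} \<Longrightarrow>
      i \<in> {1..num_nodes d k} \<Longrightarrow> node d i \<in> cell d j \<Longrightarrow> y \<in> cell d j \<Longrightarrow>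
      v_opt m k (node d i) \<le> v_opt m k y + e k"
    using v_hat_le_v_opt[OF d pol that t order_refl x] v_policy_le_v_hat[OF scheme t x] by force
qed

lemma policy_gap_le_lipschitz:
  assumes scheme: "convex_scheme m Z d \<pi>" and t: "t \<le> horizon m" and x: "x \<in> Z t"
  shows "ennreal (v_policy m \<pi> t x - v_opt m t x)
    \<le> (\<Sum>k=t+1..horizon m. cell_lipschitz m d k * ennreal (mesh m d))"
\<comment> \<open>An infinite bound is vacuous. Otherwise every term is finite and can be used as a
  real error in \<open>policy_gap_le\<close>.\<close>
proof (cases "(\<Sum>k=t+1..horizon m. cell_lipschitz m d k * ennreal (mesh m d)) = \<top>")
  case False
  let ?L = "\<lambda>k. cell_lipschitz m d k * ennreal (mesh m d)"
  have d: "discretization m Z d"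
    using scheme by (simp add: convex_scheme_def)
  have fin: "?L k < \<top>" if "k \<in> {t+1..horizon m}" for k
    using False that by (auto simp: less_top)
  have "v_policy m \<pi> t x - v_opt m t x \<le> (\<Sum>k=t+1..horizon m. enn2real (?L k))"
  proof (rule policy_gap_le[OF scheme t x])
    fix k j i y assume k: "t < k" "k \<le> horizon m" and j: "j \<in> {1..num_cells d k}"
      and i: "i \<in> {1..num_nodes d k}" "node d i \<in> cell d j" and y: "y \<in> cell d j"
    have "ennreal (v_opt m k (node d i) - v_opt m k y) \<le> ?L k"
      using norm_node_diff_le_mesh[OF d k(2) j i y] by (intro v_opt_diff_le_lipschitz[OF j i(2) y])
    also have "\<dots> = ennreal (enn2real (?L k))"
      using fin[of k] k by simp
    finally show "v_opt m k (node d i) \<le> v_opt m k y + enn2real (?L k)"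
      by (simp add: ennreal_le_iff)
  qed
  then have "ennreal (v_policy m \<pi> t x - v_opt m t x) \<le> ennreal (\<Sum>k=t+1..horizon m. enn2real (?L k))"
    by (rule ennreal_leI)
  also have "\<dots> = (\<Sum>k=t+1..horizon m. ennreal (enn2real (?L k)))"
    by (rule sum_ennreal[symmetric]) simp
  also have "\<dots> = (\<Sum>k=t+1..horizon m. ?L k)"
    using fin by (intro sum.cong) auto
  finally show ?thesis .
next
  case True
  then show ?thesis by (simp only: top_greatest)
qed

text \<open>Uniform continuity of \<open>v_opt\<close> on the compact region replaces the Lipschitz
  constants, which may be infinite.\<close>

lemma eventually_oscillation_less:
  assumes conv: "convex_on (Z k) (v_opt m k)" and k: "k \<le> horizon m" and \<epsilon>: "0 < \<epsilon>"
  shows "\<forall>\<^sub>F (d, \<pi>) in mesh_to_0 m Z. \<forall>j i y. j \<in> {1..num_cells d k} \<longrightarrow>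
      i \<in> {1..num_nodes d k} \<longrightarrow> node d i \<in> cell d j \<longrightarrow> y \<in> cell d j \<longrightarrow>
      v_opt m k (node d i) \<le> v_opt m k y + \<epsilon>"
\<comment> \<open>One scheme is enough to know that the fixed region is a polytope; if there is
  none, the claim about all schemes is vacuous.\<close>
proof (cases "\<exists>d \<pi>. convex_scheme m Z d \<pi>")
  case True
  then obtain d0 where d0: "discretization m Z d0" by (auto simp: convex_scheme_def)
  have Z: "convex (Z k)" "compact (Z k)"
    using regions k by (auto simp: state_regions_def)
  have "continuous_on (Z k) (v_opt m k)"
    by (intro convex_lsc_on_polytope_imp_continuous Z_polytope[OF d0] conv lsc_on_v_opt k Z)
  then have "uniformly_continuous_on (Z k) (v_opt m k)"
    using Z(2) by (rule compact_uniformly_continuous)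
  then obtain \<eta> where \<eta>: "\<eta> > 0" "\<And>x y. x \<in> Z k \<Longrightarrow> y \<in> Z k \<Longrightarrow> dist x y < \<eta> \<Longrightarrow>
      dist (v_opt m k x) (v_opt m k y) < \<epsilon>"
    using \<epsilon> unfolding uniformly_continuous_on_def by metis
  have "v_opt m k (node d i) \<le> v_opt m k y + \<epsilon>"
    if d: "discretization m Z d" "mesh m d < \<eta>" and j: "j \<in> {1..num_cells d k}"
      and i: "i \<in> {1..num_nodes d k}" "node d i \<in> cell d j" and y: "y \<in> cell d j" for d j i y
  proof -
    have "(\<Union>j\<in>{1..num_cells d k}. cell d j) = Z k"
      using d(1) k by (simp add: discretization_def Let_def)
    then have "node d i \<in> Z k" "y \<in> Z k" using i y j by blast+
    moreover have "dist (node d i) y < \<eta>"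
      using norm_node_diff_le_mesh[OF d(1) k j i y] d(2) by (simp add: dist_norm)
    ultimately have "dist (v_opt m k (node d i)) (v_opt m k y) < \<epsilon>"
      using \<eta>(2) by blast
    then show ?thesis by (simp add: dist_real_def)
  qed
  then show ?thesis
    unfolding eventually_mesh_to_0 using \<eta>(1)
    by (intro exI[of _ \<eta>]) (auto simp: convex_scheme_def)
next
  case False
  then show ?thesis
    unfolding eventually_mesh_to_0 by (intro exI[of _ 1]) auto
qed

lemma uniform_limit_v_policy:
  assumes conv: "\<And>k. k \<le> horizon m \<Longrightarrow> convex_on (Z k) (v_opt m k)" and t: "t \<le> horizon m"
  shows "uniform_limit (Z t) (\<lambda>(d, \<pi>). v_policy m \<pi> t) (v_opt m t) (mesh_to_0 m Z)"
proof (rule uniform_limitI)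
  fix \<epsilon> :: real assume \<epsilon>: "0 < \<epsilon>"
  \<comment> \<open>At most \<open>horizon m\<close> stages contribute an error; the added 1 keeps
    their total strictly below \<open>\<epsilon>\<close>.\<close>
  define \<epsilon>' where "\<epsilon>' = \<epsilon> / (real (horizon m) + 1)"
  have \<epsilon>': "0 < \<epsilon>'" "real (horizon m) * \<epsilon>' < \<epsilon>"
    using \<epsilon> by (auto simp: \<epsilon>'_def field_simps)
  have "\<forall>\<^sub>F p in mesh_to_0 m Z. \<forall>k\<in>{..horizon m}. case p of (d, \<pi>) \<Rightarrow>
      \<forall>j i y. j \<in> {1..num_cells d k} \<longrightarrow>
      i \<in> {1..num_nodes d k} \<longrightarrow> node d i \<in> cell d j \<longrightarrow> y \<in> cell d j \<longrightarrow>
      v_opt m k (node d i) \<le> v_opt m k y + \<epsilon>'"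
    using \<epsilon>'(1) conv by (intro eventually_ball_finite ballI eventually_oscillation_less) auto
  \<comment> \<open>The principal part of the filter, recovered so that \<open>policy_gap\<close>
    applies.\<close>
  moreover have "\<forall>\<^sub>F (d, \<pi>) in mesh_to_0 m Z. convex_scheme m Z d \<pi>"
    unfolding eventually_mesh_to_0 by (intro exI[of _ 1]) auto
  ultimately show "\<forall>\<^sub>F p in mesh_to_0 m Z. \<forall>x\<in>Z t.
      dist ((case p of (d, \<pi>) \<Rightarrow> v_policy m \<pi> t) x) (v_opt m t x) < \<epsilon>"
  proof eventually_elim
    case (elim p)
    obtain d \<pi> where p: "p = (d, \<pi>)" by fastforce
    from elim(2) have scheme: "convex_scheme m Z d \<pi>" by (simp add: p)
    show ?case
    proof
      fix x assume x: "x \<in> Z t"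
      have "v_policy m \<pi> t x - v_opt m t x \<le> (\<Sum>k=t+1..horizon m. \<epsilon>')"
        using elim(1) by (intro policy_gap_le[OF scheme t x]) (auto simp: p)
      also have "\<dots> \<le> real (horizon m) * \<epsilon>'"
        using \<epsilon>'(1) by simp
      also have "\<dots> < \<epsilon>" by fact
      finally show "dist ((case p of (d, \<pi>) \<Rightarrow> v_policy m \<pi> t) x) (v_opt m t x) < \<epsilon>"
        using policy_gap_nonneg[OF scheme t x] by (simp add: p dist_real_def)
    qed
  qed
qed

end

theorem theorem2:
  fixes m :: "('n::finite, 'm::finite, 'l::finite, 'w) control_problem"
    and Z :: "nat \<Rightarrow> (real ^ 'n) set"
  assumes "semicontinuous_model m"
    and "state_regions m Z"
    and "\<forall>t\<le>horizon m. convex_on (Z t) (v_opt m t)"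
  shows "(\<forall>d \<pi>. convex_scheme m Z d \<pi> \<longrightarrow>
            (\<forall>t\<le>horizon m. \<forall>x\<in>Z t.
               0 \<le> v_policy m \<pi> t x - v_opt m t x \<and>
               ennreal (v_policy m \<pi> t x - v_opt m t x)
                 \<le> (\<Sum>k=t+1..horizon m. cell_lipschitz m d k * ennreal (mesh m d)))) \<and>
         (\<forall>t\<le>horizon m.
            uniform_limit (Z t) (\<lambda>(d, \<pi>). v_policy m \<pi> t) (v_opt m t) (mesh_to_0 m Z))"
proof -
  interpret semicontinuous_control m Z
    by unfold_locales (use assms in auto)
  show ?thesis
    using policy_gap_nonneg policy_gap_le_lipschitz uniform_limit_v_policy assms(3) by blast
qed

end
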